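(* There exists a mapping $F:\mathbb{C}\times\mathbb{R}\to\mathbb{C}\times\mathbb{R}$ of the form $F(z,w)=(h_1(z,w),h_2(w))$, where $h_1$ is (the restriction to $\mathbb{C}\times\mathbb{R}$ of) a transcendental entire function of the variables $z,w$ and $h_2:\mathbb{R}\to\mathbb{R}$ is a real-valued function, such that $F$ has infinitely many (distinct) attracting Fatou components.
   Context: For a map $F:\mathbb{C}\times\mathbb{R}\to\mathbb{C}\times\mathbb{R}$, $F^n$ denotes the $n$-th iterate. The Fatou set $\mathscr{F}(F)$ is the largest open subset of $\mathbb{C}\times\mathbb{R}$ on which the family of iterates $\{F^n\}_{n\in\mathbb{N}}$ is normal. Here normal means that every sequence in the family has a subsequence that either converges locally uniformly to a map into $\mathbb{C}\times\mathbb{R}$ or tends locally uniformly to $\infty$. A Fatou component is a connected component of the Fatou set. A Fatou component $U$ is periodic if $F^p(U)\subset U$ for some $p\ge 1$. A periodic Fatou component $U$ is attracting if every point of $U$ converges under iteration to a periodic point lying in $U$; that is, there are $p\ge 1$ with $F^p(U)\subset U$ and a point $q\in U$ with $F^p(q)=q$ such that $F^{pn}(x)\to q$ as $n\to\infty$ for every $x\in U$. An entire function is transcendental if it is not a polynomial. *)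

theory Defs
  imports "HOL-Analysis.Analysis"
begin

(* The Frechet derivative must be complex linear, i.e. of the form (u, v) \<mapsto> a u + b v. *)
definition entire2 :: "(complex \<times> complex \<Rightarrow> complex) \<Rightarrow> bool" where
  "entire2 H \<longleftrightarrow> (\<forall>x. \<exists>a b. (H has_derivative (\<lambda>(u, v). a * u + b * v)) (at x))"

definition polynomial2 :: "(complex \<times> complex \<Rightarrow> complex) \<Rightarrow> bool" where
  "polynomial2 H \<longleftrightarrow>
     (\<exists>(N::nat) (c::nat \<Rightarrow> nat \<Rightarrow> complex). \<forall>z w. H (z, w) = (\<Sum>i\<le>N. \<Sum>j\<le>N. c i j * z ^ i * w ^ j))"

definition transcendental_entire2 :: "(complex \<times> complex \<Rightarrow> complex) \<Rightarrow> bool" where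
  "transcendental_entire2 H \<longleftrightarrow> entire2 H \<and> \<not> polynomial2 H"

definition loc_uniform_limit_on ::
  "'a::topological_space set \<Rightarrow> (nat \<Rightarrow> 'a \<Rightarrow> 'b::metric_space) \<Rightarrow> ('a \<Rightarrow> 'b) \<Rightarrow> bool" where
  "loc_uniform_limit_on V f g \<longleftrightarrow>
     (\<forall>x\<in>V. \<exists>W. open W \<and> x \<in> W \<and> W \<subseteq> V \<and> uniform_limit W f g sequentially)"

definition loc_uniform_infinity_on ::
  "'a::topological_space set \<Rightarrow> (nat \<Rightarrow> 'a \<Rightarrow> 'b::real_normed_vector) \<Rightarrow> bool" where
  "loc_uniform_infinity_on V f \<longleftrightarrow>
     (\<forall>x\<in>V. \<exists>W. open W \<and> x \<in> W \<and> W \<subseteq> V \<and>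
        (\<forall>B. \<forall>\<^sub>F n in sequentially. \<forall>y\<in>W. B \<le> norm (f n y)))"

(* For open V. Sequences in the family may repeat members. *)
definition normal_family_on ::
  "'a::topological_space set \<Rightarrow> ('a \<Rightarrow> 'b::real_normed_vector) set \<Rightarrow> bool" where
  "normal_family_on V \<F> \<longleftrightarrow>
     (\<forall>f :: nat \<Rightarrow> 'a \<Rightarrow> 'b. range f \<subseteq> \<F> \<longrightarrow>
        (\<exists>r :: nat \<Rightarrow> nat. strict_mono r \<and>
           ((\<exists>g. loc_uniform_limit_on V (f \<circ> r) g) \<or> loc_uniform_infinity_on V (f \<circ> r))))"

(* Normality is understood locally: since a subsequence may converge on one component of an
   open set and tend to infinity on another, a union of open sets of normality need not satisfy
   normal_family_on itself. The Fatou set is the set of points with a neighbourhood of normality. *)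
definition fatou_set :: "('a::real_normed_vector \<Rightarrow> 'a) \<Rightarrow> 'a set" where
  "fatou_set F = \<Union> {V. open V \<and> normal_family_on V (range (\<lambda>n::nat. F ^^ n))}"

definition fatou_component :: "('a::real_normed_vector \<Rightarrow> 'a) \<Rightarrow> 'a set \<Rightarrow> bool" where
  "fatou_component F U \<longleftrightarrow> U \<in> components (fatou_set F)"

definition attracting_fatou_component :: "('a::real_normed_vector \<Rightarrow> 'a) \<Rightarrow> 'a set \<Rightarrow> bool" where
  "attracting_fatou_component F U \<longleftrightarrow> fatou_component F U \<and>
     (\<exists>p\<ge>1. (F ^^ p) ` U \<subseteq> U \<and>
        (\<exists>q\<in>U. (F ^^ p) q = q \<and> (\<forall>x\<in>U. (\<lambda>n. (F ^^ (p * n)) x) \<longlonglongrightarrow> q)))"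

end

theory Submission
  imports Defs
begin

text \<open>
  Take \<open>H (z, w) = sin w\<close> and \<open>h\<^sub>2 w = w - sin w / 2\<close>. On the real line \<open>h\<^sub>2\<close> is increasing and
  commutes with the translation by \<open>2\<pi>\<close>; its fixed points are the multiples of \<open>\<pi>\<close>, of which the
  even ones attract and the odd ones repel. Each open interval of radius \<open>\<pi>\<close> about \<open>2\<pi>k\<close> is
  attracted to \<open>2\<pi>k\<close>, and by monotonicity the convergence is locally uniform. The first
  coordinate after \<open>n + 1\<close> steps is \<open>sin (h\<^sub>2\<^sup>n w)\<close>, so it converges to \<open>0\<close> at the same rate.
  Hence on the strip \<open>\<complex> \<times> (2\<pi>k - \<pi>, 2\<pi>k + \<pi>)\<close> the iterates of \<open>F\<close> converge locally uniformly
  to the fixed point \<open>(0, 2\<pi>k)\<close>, and they form a normal family there.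

  Along a line \<open>w = 2\<pi>k + \<pi>\<close> normality fails: the iterates stay bounded at its points, and any
  limit function would be discontinuous, as it has second coordinate \<open>2\<pi>k + \<pi>\<close> on the
  line and \<open>2\<pi>k\<close> just below it. So these lines separate the strips, each strip is a
  connected component of the Fatou set, and it is attracting with period 1.
\<close>

section \<open>Normality of a convergent sequence\<close>

text \<open>A sequence in the range of \<open>f\<close> need not be a subsequence of \<open>f\<close>: it may repeat and permute
  members. Either it takes one value infinitely often, or its indices tend to infinity and it
  converges itself.\<close>

lemma normal_family_on_range_convergent:
  fixes f :: "nat \<Rightarrow> 'a::topological_space \<Rightarrow> 'b::real_normed_vector"
  assumes lim: "loc_uniform_limit_on V f g"
  shows "normal_family_on V (range f)"
  unfolding normal_family_on_def
proof (intro allI impI)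
  fix s :: "nat \<Rightarrow> 'a \<Rightarrow> 'b"
  assume "range s \<subseteq> range f"
  then have "\<forall>j. \<exists>m. s j = f m" by blast
  then obtain idx where idx: "\<And>j. s j = f (idx j)" by metis
  show "\<exists>r. strict_mono r \<and>
    ((\<exists>g. loc_uniform_limit_on V (s \<circ> r) g) \<or> loc_uniform_infinity_on V (s \<circ> r))"
  proof (cases "\<exists>m. infinite {j. idx j = m}")
    case True
    then obtain m where "infinite {j. idx j = m}" by blast
    then obtain r :: "nat \<Rightarrow> nat" where r: "strict_mono r" "\<And>n. r n \<in> {j. idx j = m}"
      using infinite_enumerate by blast
    have "s \<circ> r = (\<lambda>n. f m)" using r(2) idx by auto
    then have "uniform_limit W (s \<circ> r) (f m) sequentially" for W
      by (simp add: uniform_limit_const)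
    then have "loc_uniform_limit_on V (s \<circ> r) (f m)"
      using lim unfolding loc_uniform_limit_on_def by meson
    with r(1) show ?thesis by (intro exI[of _ r] conjI disjI1 exI[of _ "f m"])
  next
    case False
    have "filterlim idx at_top sequentially"
      unfolding filterlim_at_top
    proof
      fix m :: nat
      have "{j. idx j < m} = (\<Union>i<m. {j. idx j = i})" by auto
      then have "finite {j. idx j < m}" using False by simp
      then have "\<forall>\<^sub>F j in cofinite. \<not> idx j < m" by (simp add: eventually_cofinite)
      then show "\<forall>\<^sub>F j in sequentially. m \<le> idx j"
        by (simp add: cofinite_eq_sequentially not_less)
    qed
    then have "uniform_limit W (\<lambda>j. f (idx j)) g sequentially"
      if "uniform_limit W f g sequentially" for W
      using that by (rule filterlim_compose[rotated])
    then have "loc_uniform_limit_on V (\<lambda>j. f (idx j)) g"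
      using lim unfolding loc_uniform_limit_on_def by meson
    moreover have "s \<circ> id = (\<lambda>j. f (idx j))" using idx by auto
    moreover have "strict_mono (id :: nat \<Rightarrow> nat)" by (simp add: strict_mono_def)
    ultimately show ?thesis by metis
  qed
qed

section \<open>The sine is not a polynomial\<close>

lemma transcendental_entire2_sin_snd: "transcendental_entire2 (\<lambda>x. sin (snd x))"
  unfolding transcendental_entire2_def
proof
  show "entire2 (\<lambda>x. sin (snd x))"
    unfolding entire2_def
  proof
    fix x :: "complex \<times> complex"
    have "((\<lambda>x. sin (snd x)) has_derivative (\<lambda>h. snd h * cos (snd x))) (at x)"
      using has_derivative_compose[OF has_derivative_snd[OF has_derivative_ident],
          where g = sin, OF DERIV_sin[unfolded has_field_derivative_def]]
      by (simp add: mult.commute)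
    moreover have "(\<lambda>h. snd h * cos (snd x)) = (\<lambda>(u, v). 0 * u + cos (snd x) * v)"
      by (auto simp: fun_eq_iff)
    ultimately show "\<exists>a b. ((\<lambda>x. sin (snd x)) has_derivative (\<lambda>(u, v). a * u + b * v)) (at x)"
      by metis
  qed
  show "\<not> polynomial2 (\<lambda>x. sin (snd x))"
  proof
    assume "polynomial2 (\<lambda>x. sin (snd x))"
    then obtain N c where
      c: "\<And>z w :: complex. sin w = (\<Sum>i\<le>N. \<Sum>j\<le>N. c i j * z ^ i * w ^ j)"
      unfolding polynomial2_def by auto
    \<comment> \<open>Setting \<open>z = 0\<close> gives a polynomial in \<open>w\<close> alone, which has too many zeros.\<close>
    define d where "d j = (\<Sum>i\<le>N. c i j * 0 ^ i)" for j
    have d: "sin w = (\<Sum>j\<le>N. d j * w ^ j)" for w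
      unfolding d_def sum_distrib_right by (subst sum.swap) (rule c)
    have "range (\<lambda>n::int. complex_of_real (2 * pi * of_int n)) \<subseteq> {w. (\<Sum>j\<le>N. d j * w ^ j) = 0}"
      by (auto simp flip: d simp: sin_of_real simp del: of_real_mult)
    moreover have "infinite (range (\<lambda>n::int. complex_of_real (2 * pi * of_int n)))"
      by (simp add: finite_image_iff inj_def infinite_UNIV_char_0)
    ultimately have "infinite {w. (\<Sum>j\<le>N. d j * w ^ j) = 0}"
      using finite_subset by blast
    then have "\<forall>j\<le>N. d j = 0" using polyfun_finite_roots[of d N] by blast
    then have "sin (complex_of_real (pi / 2)) = 0" by (subst d) simp
    then show False by (simp only: sin_of_real sin_pi_half) simp
  qed
qed

section \<open>Dynamics on the real line\<close>

text \<open>The map \<open>h\<^sub>2\<close> of the theorem. With the minus sign the attracting fixed points are the multiples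
  of \<open>2\<pi>\<close>, so \<open>h\<^sub>2\<close> is odd about each of them and everything reduces to the interval \<open>[0, \<pi>)\<close>.\<close>

definition sine_step :: "real \<Rightarrow> real" where
  "sine_step w = w - sin w / 2"

lemma mono_sine_step: "mono sine_step"
proof
  fix x y :: real
  assume "x \<le> y"
  show "sine_step x \<le> sine_step y"
    unfolding sine_step_def
  proof (rule DERIV_nonneg_imp_nondecreasing[OF \<open>x \<le> y\<close>])
    fix t :: real
    have "((\<lambda>w. w - sin w / 2) has_real_derivative 1 - cos t / 2) (at t)"
      by (auto intro!: derivative_eq_intros)
    moreover have "0 \<le> 1 - cos t / 2" using cos_le_one[of t] by linarith
    ultimately show "\<exists>D. ((\<lambda>w. w - sin w / 2) has_real_derivative D) (at t) \<and> 0 \<le> D"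
      by blast
  qed
qed

lemma continuous_on_sine_step [continuous_intros]:
  fixes f :: "'a::metric_space \<Rightarrow> real"
  shows   "continuous_on S f \<Longrightarrow> continuous_on S (\<lambda>x. sine_step (f x))"
  unfolding sine_step_def by (intro continuous_intros continuous_on_sin) auto

lemma continuous_on_sine_step_funpow: "continuous_on S (sine_step ^^ n)"
  by (induction n) (auto simp: comp_def intro!: continuous_intros)

lemma sin_plus_2pi_int: "sin (t + 2 * pi * of_int k) = sin t"
  using sin_int_2pin[of k] cos_int_2pin[of k] by (simp add: sin_add)

lemma sine_step_translate: "sine_step (t + 2 * pi * of_int k) = sine_step t + 2 * pi * of_int k"
  by (simp add: sine_step_def sin_plus_2pi_int)

lemma sine_step_funpow_translate:
  "(sine_step ^^ n) (t + 2 * pi * of_int k) = (sine_step ^^ n) t + 2 * pi * of_int k"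
  by (induction n) (simp_all add: sine_step_translate)

lemma sine_step_funpow_minus: "(sine_step ^^ n) (- t) = - (sine_step ^^ n) t"
  by (induction n) (simp_all add: sine_step_def)

lemma sine_step_funpow_fixed: "sin t = 0 \<Longrightarrow> (sine_step ^^ n) t = t"
  by (induction n) (simp_all add: sine_step_def)

lemma mono_sine_step_funpow: "x \<le> y \<Longrightarrow> (sine_step ^^ n) x \<le> (sine_step ^^ n) y"
  by (induction n) (auto intro: monoD[OF mono_sine_step])

lemma sine_step_funpow_nonneg: "0 \<le> t \<Longrightarrow> 0 \<le> (sine_step ^^ n) t"
  using mono_sine_step_funpow[of 0 t n] sine_step_funpow_fixed[of 0 n] by simp

lemma abs_sine_step_funpow: "\<bar>(sine_step ^^ n) t\<bar> = (sine_step ^^ n) \<bar>t\<bar>"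
proof (cases "0 \<le> t")
  case True
  then show ?thesis using sine_step_funpow_nonneg by simp
next
  case False
  then show ?thesis
    using sine_step_funpow_nonneg[of "- t" n] by (simp add: sine_step_funpow_minus)
qed

lemma sine_step_funpow_bounds:
  assumes "0 \<le> b" "b \<le> pi"
  shows "(sine_step ^^ n) b \<in> {0..b}" "(sine_step ^^ Suc n) b \<le> (sine_step ^^ n) b"
proof -
  have decr: "sine_step t \<le> t" if "0 \<le> t" "t \<le> pi" for t
    using sin_ge_zero[OF that] by (simp add: sine_step_def)
  show *: "(sine_step ^^ n) b \<in> {0..b}" for n
  proof (induction n)
    case (Suc n)
    then show ?case
      using decr[of "(sine_step ^^ n) b"] sine_step_funpow_nonneg[of b "Suc n"] assms by auto
  qed (use assms in simp)
  show "(sine_step ^^ Suc n) b \<le> (sine_step ^^ n) b"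
    using decr[of "(sine_step ^^ n) b"] *[of n] assms by auto
qed

lemma sine_step_funpow_tendsto_0:
  assumes "0 \<le> b" "b < pi"
  shows "(\<lambda>n. (sine_step ^^ n) b) \<longlonglongrightarrow> 0"
proof -
  let ?X = "\<lambda>n. (sine_step ^^ n) b"
  note bnd = sine_step_funpow_bounds[OF assms(1) less_imp_le[OF assms(2)]]
  have "decseq ?X" using bnd(2) by (rule decseq_SucI)
  moreover have "\<forall>n. 0 \<le> ?X n" using bnd(1) by simp
  ultimately obtain L where L: "?X \<longlonglongrightarrow> L" "\<forall>n. L \<le> ?X n"
    using decseq_convergent by metis
  have "0 \<le> L" using LIMSEQ_le_const[OF L(1)] bnd(1) by auto
  moreover have "L < pi" using L(2)[rule_format, of 0] assms(2) by simp
  moreover have "sin L = 0"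
  proof -
    have "(\<lambda>n. sine_step (?X n)) \<longlonglongrightarrow> sine_step L"
      using continuous_on_tendsto_compose[OF continuous_on_sine_step[OF continuous_on_id],
          where s = UNIV, OF L(1)]
      by simp
    moreover have "(\<lambda>n. sine_step (?X n)) \<longlonglongrightarrow> L"
      using LIMSEQ_Suc[OF L(1)] by simp
    ultimately have "sine_step L = L" using LIMSEQ_unique by blast
    then show ?thesis by (simp add: sine_step_def)
  qed
  ultimately have "L = 0" using sin_gt_zero[of L] by force
  then show ?thesis using L(1) by simp
qed

section \<open>The skew product and its Fatou set\<close>

text \<open>The map \<open>F\<close> of the theorem. Its first coordinate does not depend on \<open>z\<close>, so after one step
  the dynamics is governed by the second coordinate alone.\<close>

definition sine_skew :: "complex \<times> real \<Rightarrow> complex \<times> real" where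
  "sine_skew x = (sin (complex_of_real (snd x)), sine_step (snd x))"

lemma snd_sine_skew_funpow [simp]: "snd ((sine_skew ^^ n) x) = (sine_step ^^ n) (snd x)"
  by (induction n) (simp_all add: sine_skew_def)

lemma sine_skew_funpow_Suc:
  "(sine_skew ^^ Suc n) x =
     (complex_of_real (sin ((sine_step ^^ n) (snd x))), (sine_step ^^ Suc n) (snd x))"
  by (simp add: sine_skew_def[of "(sine_skew ^^ n) x"] sin_of_real)

lemma continuous_on_sine_skew_funpow: "continuous_on S (sine_skew ^^ n)"
proof (induction n)
  case 0
  then show ?case by (simp add: id_def)
next
  case (Suc n)
  have "continuous_on S (\<lambda>x. (sine_step ^^ m) (snd x))" for m
    using continuous_on_sine_step_funpow[of UNIV m]
    by (rule continuous_on_compose2) (auto intro!: continuous_intros)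
  then have "continuous_on S (\<lambda>x. (complex_of_real (sin ((sine_step ^^ n) (snd x))),
      (sine_step ^^ Suc n) (snd x)))"
    by (intro continuous_intros)
  then show ?case by (subst (asm) sine_skew_funpow_Suc[symmetric])
qed

text \<open>The open strip of half-width \<open>\<pi>\<close> around the attracting line \<open>w = 2\<pi>k\<close>.\<close>

definition strip :: "int \<Rightarrow> (complex \<times> real) set" where
  "strip k = UNIV \<times> {2 * pi * of_int k - pi <..< 2 * pi * of_int k + pi}"

lemma open_strip: "open (strip k)"
  unfolding strip_def by (intro open_Times) auto

lemma connected_strip: "connected (strip k)"
  unfolding strip_def by (intro connected_Times) auto

lemma center_in_strip: "(0, 2 * pi * of_int k) \<in> strip k"
  by (simp add: strip_def)

lemma sine_skew_strip: "sine_skew ` strip k \<subseteq> strip k"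
proof -
  have "\<bar>sine_step w - 2 * pi * of_int k\<bar> < pi" if "\<bar>w - 2 * pi * of_int k\<bar> < pi" for w
    using sine_step_funpow_bounds(2)[of "\<bar>w - 2 * pi * of_int k\<bar>" 0] that
      abs_sine_step_funpow[of 1 "w - 2 * pi * of_int k"]
      sine_step_funpow_translate[of 1 "w - 2 * pi * of_int k" k]
    by simp
  moreover have "x \<in> strip k \<longleftrightarrow> \<bar>snd x - 2 * pi * of_int k\<bar> < pi" for x
    by (auto simp: strip_def mem_Times_iff abs_less_iff)
  ultimately show ?thesis by (auto simp: sine_skew_def)
qed

text \<open>By oddness and monotonicity of \<open>h\<^sub>2\<close>, the distance from \<open>2\<pi>k\<close> of the \<open>n\<close>-th second coordinate
  is at most the \<open>n\<close>-th iterate of \<open>h\<^sub>2\<close> at \<open>b\<close>, uniformly on \<open>W\<close>.\<close>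

lemma uniform_limit_sine_skew:
  assumes b: "0 \<le> b" "b < pi"
    and W: "\<And>x. x \<in> W \<Longrightarrow> \<bar>snd x - 2 * pi * of_int k\<bar> \<le> b"
  shows "uniform_limit W (\<lambda>n. sine_skew ^^ n) (\<lambda>_. (0, 2 * pi * of_int k)) sequentially"
proof -
  let ?q = "(0, 2 * pi * of_int k) :: complex \<times> real"
  have est: "dist ((sine_skew ^^ Suc n) x) ?q \<le> 2 * (sine_step ^^ n) b" if "x \<in> W" for n x
  proof -
    define t where "t = snd x - 2 * pi * of_int k"
    have abs_t: "\<bar>(sine_step ^^ m) t\<bar> \<le> (sine_step ^^ m) b" for m
      using mono_sine_step_funpow[of "\<bar>t\<bar>" b m] W[OF that] by (simp add: abs_sine_step_funpow t_def)
    have tr: "(sine_step ^^ m) (snd x) = (sine_step ^^ m) t + 2 * pi * of_int k" for m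
      using sine_step_funpow_translate[of m t k] by (simp add: t_def)
    have "dist ((sine_skew ^^ Suc n) x) ?q =
        norm (complex_of_real (sin ((sine_step ^^ n) t)), (sine_step ^^ Suc n) t)"
      unfolding sine_skew_funpow_Suc tr sin_plus_2pi_int by (simp add: dist_norm)
    also have "\<dots> \<le> \<bar>sin ((sine_step ^^ n) t)\<bar> + \<bar>(sine_step ^^ Suc n) t\<bar>"
      using norm_Pair_le[of "complex_of_real (sin ((sine_step ^^ n) t))" "(sine_step ^^ Suc n) t"]
      by simp
    also have "\<dots> \<le> (sine_step ^^ n) b + (sine_step ^^ n) b"
      using abs_sin_x_le_abs_x[of "(sine_step ^^ n) t"] abs_t[of n] abs_t[of "Suc n"]
        sine_step_funpow_bounds(2)[of b n] b by linarith
    finally show ?thesis by simp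
  qed
  have "(\<lambda>n. 2 * (sine_step ^^ n) b) \<longlonglongrightarrow> 0"
    using tendsto_mult_right_zero[OF sine_step_funpow_tendsto_0[OF b]] .
  then have ev: "\<forall>\<^sub>F n in sequentially. 2 * (sine_step ^^ n) b < e" if "0 < e" for e
    using that by (rule order_tendstoD)
  have "\<forall>\<^sub>F n in sequentially. \<forall>x\<in>W. dist ((sine_skew ^^ n) x) ?q < e" if "0 < e" for e
  proof (subst eventually_sequentially_Suc[symmetric])
    show "\<forall>\<^sub>F n in sequentially. \<forall>x\<in>W. dist ((sine_skew ^^ Suc n) x) ?q < e"
      using ev[OF that] by eventually_elim (blast intro: le_less_trans[OF est])
  qed
  then show ?thesis unfolding uniform_limit_iff by blast
qed

lemma loc_uniform_limit_on_strip:
  "loc_uniform_limit_on (strip k) (\<lambda>n. sine_skew ^^ n) (\<lambda>_. (0, 2 * pi * of_int k))"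
  unfolding loc_uniform_limit_on_def
proof
  fix x
  assume "x \<in> strip k"
  then have "\<bar>snd x - 2 * pi * of_int k\<bar> < pi"
    by (auto simp: strip_def abs_less_iff)
  then obtain b where b: "\<bar>snd x - 2 * pi * of_int k\<bar> < b" "b < pi"
    using dense by blast
  define W where "W = (UNIV :: complex set) \<times> {2 * pi * of_int k - b <..< 2 * pi * of_int k + b}"
  have "open W" unfolding W_def by (intro open_Times) auto
  moreover have "x \<in> W" using b by (auto simp: W_def mem_Times_iff)
  moreover have "W \<subseteq> strip k" using b by (auto simp: W_def strip_def)
  moreover have "uniform_limit W (\<lambda>n. sine_skew ^^ n) (\<lambda>_. (0, 2 * pi * of_int k)) sequentially"
    using b by (intro uniform_limit_sine_skew[of b]) (auto simp: W_def)
  ultimately show "\<exists>W. open W \<and> x \<in> W \<and> W \<subseteq> strip k \<and>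
      uniform_limit W (\<lambda>n. sine_skew ^^ n) (\<lambda>_. (0, 2 * pi * of_int k)) sequentially"
    by blast
qed

lemma strip_subset_fatou_set: "strip k \<subseteq> fatou_set sine_skew"
  using open_strip normal_family_on_range_convergent[OF loc_uniform_limit_on_strip]
  unfolding fatou_set_def by blast

lemma sine_skew_funpow_tendsto:
  assumes "x \<in> strip k"
  shows "(\<lambda>n. (sine_skew ^^ n) x) \<longlonglongrightarrow> (0, 2 * pi * of_int k)"
proof -
  obtain W where "x \<in> W"
    and "uniform_limit W (\<lambda>n. sine_skew ^^ n) (\<lambda>_. (0, 2 * pi * of_int k)) sequentially"
    using loc_uniform_limit_on_strip assms unfolding loc_uniform_limit_on_def by blast
  then show ?thesis using tendsto_uniform_limitI by fastforce
qed

lemma repelling_line_not_in_fatou_set: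
  "(z, 2 * pi * of_int k + pi) \<notin> fatou_set sine_skew"
proof
  let ?w = "2 * pi * of_int k + pi"
  assume "(z, ?w) \<in> fatou_set sine_skew"
  then obtain V where V: "(z, ?w) \<in> V" "normal_family_on V (range (\<lambda>n. sine_skew ^^ n))"
    unfolding fatou_set_def by blast
  have "range (\<lambda>n. sine_skew ^^ n) \<subseteq> range (\<lambda>n. sine_skew ^^ n)" by simp
  then obtain r where r: "strict_mono r"
    and alt: "(\<exists>g. loc_uniform_limit_on V ((\<lambda>n. sine_skew ^^ n) \<circ> r) g) \<or>
      loc_uniform_infinity_on V ((\<lambda>n. sine_skew ^^ n) \<circ> r)"
    using V(2) unfolding normal_family_on_def by blast
  have sin_w: "sin ?w = 0" using sin_plus_2pi_int[of pi k] by (simp add: add.commute)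
  from alt show False
  proof
    assume "\<exists>g. loc_uniform_limit_on V ((\<lambda>n. sine_skew ^^ n) \<circ> r) g"
    then obtain g W where W: "open W" "(z, ?w) \<in> W"
      and lim: "uniform_limit W (\<lambda>n. sine_skew ^^ r n) g sequentially"
      using V(1) unfolding loc_uniform_limit_on_def comp_def by blast
    have cont: "continuous_on W g"
      by (rule uniform_limit_theorem[OF _ lim]) (simp_all add: continuous_on_sine_skew_funpow)
    have pt: "(\<lambda>n. (sine_skew ^^ r n) x) \<longlonglongrightarrow> g x" if "x \<in> W" for x
      using tendsto_uniform_limitI[OF lim that] .
    have on_line: "snd (g (z, ?w)) = ?w"
      using tendsto_snd[OF pt[OF W(2)]] sine_step_funpow_fixed[OF sin_w]
      by (simp add: LIMSEQ_const_iff)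
    \<comment> \<open>The points \<open>y m\<close> approach the line from below, inside the strip attracted to \<open>2\<pi>k\<close>.\<close>
    define y where "y m = (z, ?w - inverse (real (Suc m)))" for m
    have y_lim: "y \<longlonglongrightarrow> (z, ?w)"
      unfolding y_def
      using tendsto_Pair[OF tendsto_const tendsto_diff[OF tendsto_const LIMSEQ_inverse_real_of_nat]]
      by simp
    have y_W: "\<forall>\<^sub>F m in sequentially. y m \<in> W"
      using topological_tendstoD[OF y_lim W] .
    have y_strip: "y m \<in> strip k" for m
    proof -
      have "inverse (real (Suc m)) \<le> 1" by (simp add: field_simps)
      moreover have "0 < inverse (real (Suc m))" by simp
      ultimately show ?thesis using pi_gt3 unfolding y_def strip_def mem_Times_iff by simp
    qed
    have below: "g (y m) = (0, 2 * pi * of_int k)" if "y m \<in> W" for m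
      using LIMSEQ_unique[OF pt[OF that]
          LIMSEQ_subseq_LIMSEQ[OF sine_skew_funpow_tendsto[OF y_strip] r, unfolded comp_def]] .
    have "(\<lambda>m. g (y m)) \<longlonglongrightarrow> g (z, ?w)"
      using continuous_on_tendsto_compose[OF cont y_lim W(2) y_W] .
    moreover have "(\<lambda>m. g (y m)) \<longlonglongrightarrow> (0, 2 * pi * of_int k)"
      by (rule tendsto_eventually) (use y_W in eventually_elim, simp add: below)
    ultimately have "g (z, ?w) = (0, 2 * pi * of_int k)" using LIMSEQ_unique by blast
    then show False using on_line by simp
  next
    assume "loc_uniform_infinity_on V ((\<lambda>n. sine_skew ^^ n) \<circ> r)"
    then obtain W where "(z, ?w) \<in> W"
      and "\<forall>\<^sub>F n in sequentially. \<forall>y\<in>W. norm z + \<bar>?w\<bar> + 2 \<le> norm ((sine_skew ^^ r n) y)"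
      using V(1) unfolding loc_uniform_infinity_on_def comp_def by blast
    then obtain n where n: "norm z + \<bar>?w\<bar> + 2 \<le> norm ((sine_skew ^^ r n) (z, ?w))"
      using eventually_happens'[OF sequentially_bot] by blast
    have "norm (fst ((sine_skew ^^ r n) (z, ?w))) \<le> norm z + 1"
      by (cases "r n") (simp_all add: sine_skew_funpow_Suc add_increasing del: funpow.simps(2))
    moreover have "norm (snd ((sine_skew ^^ r n) (z, ?w))) = \<bar>?w\<bar>"
      using sine_step_funpow_fixed[OF sin_w] by simp
    moreover have "norm ((sine_skew ^^ r n) (z, ?w)) \<le>
        norm (fst ((sine_skew ^^ r n) (z, ?w))) + norm (snd ((sine_skew ^^ r n) (z, ?w)))"
      by (metis norm_Pair_le prod.collapse)
    ultimately show False using n by linarith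
  qed
qed

lemma fatou_component_strip: "fatou_component sine_skew (strip k)"
  unfolding fatou_component_def in_components_maximal
proof (intro conjI allI impI)
  show "strip k \<noteq> {}" using center_in_strip by blast
  show "strip k \<subseteq> fatou_set sine_skew" by (rule strip_subset_fatou_set)
  show "connected (strip k)" by (rule connected_strip)
next
  fix D
  assume D: "D \<noteq> {} \<and> strip k \<subseteq> D \<and> D \<subseteq> fatou_set sine_skew \<and> connected D"
  let ?c = "2 * pi * of_int k"
  \<comment> \<open>The projection of \<open>D\<close> is an interval about \<open>2\<pi>k\<close> that omits \<open>2\<pi>k \<plusminus> \<pi>\<close>.\<close>
  have conn: "connected (snd ` D)" using D by (intro connected_continuous_image continuous_intros) auto
  have mid: "?c \<in> snd ` D" using D center_in_strip[of k] by force
  have right: "?c + pi \<notin> snd ` D" using D repelling_line_not_in_fatou_set[of _ k] by force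
  \<comment> \<open>The lower edge of this strip is the upper edge of the previous one.\<close>
  have left: "?c - pi \<notin> snd ` D"
    using D repelling_line_not_in_fatou_set[of _ "k - 1"] by (force simp: algebra_simps)
  have "D \<subseteq> strip k"
  proof
    fix x
    assume "x \<in> D"
    then have x: "snd x \<in> snd ` D" by blast
    have "snd x < ?c + pi"
    proof (rule ccontr)
      assume "\<not> snd x < ?c + pi"
      then have "?c + pi \<in> snd ` D" by (intro connectedD_interval[OF conn mid x]) auto
      then show False using right by blast
    qed
    moreover have "?c - pi < snd x"
    proof (rule ccontr)
      assume "\<not> ?c - pi < snd x"
      then have "?c - pi \<in> snd ` D" by (intro connectedD_interval[OF conn x mid]) auto
      then show False using left by blast
    qed
    ultimately show "x \<in> strip k" by (simp add: strip_def mem_Times_iff)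
  qed
  then show "D = strip k" using D by blast
qed

lemma attracting_fatou_component_strip: "attracting_fatou_component sine_skew (strip k)"
  unfolding attracting_fatou_component_def
proof (intro conjI exI[of _ "1::nat"] bexI[of _ "(0, 2 * pi * of_int k)"] ballI)
  show "fatou_component sine_skew (strip k)" by (rule fatou_component_strip)
  show "(sine_skew ^^ 1) ` strip k \<subseteq> strip k" using sine_skew_strip by simp
  show "(sine_skew ^^ 1) (0, 2 * pi * of_int k) = (0, 2 * pi * of_int k)"
    by (simp add: sine_skew_def sine_step_def sin_of_real del: of_real_mult)
  show "(\<lambda>n. (sine_skew ^^ (1 * n)) x) \<longlonglongrightarrow> (0, 2 * pi * of_int k)" if "x \<in> strip k" for x
    using sine_skew_funpow_tendsto[OF that] by simp
qed (simp_all add: center_in_strip)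

lemma inj_strip: "inj strip"
proof
  fix j k :: int
  assume "strip j = strip k"
  \<comment> \<open>Then the orbit of one centre converges to both.\<close>
  then have "(0, 2 * pi * of_int j) \<in> strip k" using center_in_strip[of j] by simp
  then have "(0 :: complex, 2 * pi * real_of_int j) = (0, 2 * pi * of_int k)"
    using LIMSEQ_unique sine_skew_funpow_tendsto center_in_strip by blast
  then show "j = k" by simp
qed

theorem proposition3:
  shows "\<exists>(F :: complex \<times> real \<Rightarrow> complex \<times> real) (H :: complex \<times> complex \<Rightarrow> complex) (h2 :: real \<Rightarrow> real).
    transcendental_entire2 H \<and>
    (\<forall>z w. F (z, w) = (H (z, complex_of_real w), h2 w)) \<and>
    infinite {U. attracting_fatou_component F U}"
proof (intro exI conjI)
  show "transcendental_entire2 (\<lambda>x. sin (snd x))" by (rule transcendental_entire2_sin_snd)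
  show "\<forall>z w. sine_skew (z, w) = (sin (snd (z, complex_of_real w)), sine_step w)"
    by (simp add: sine_skew_def)
  have "range strip \<subseteq> {U. attracting_fatou_component sine_skew U}"
    using attracting_fatou_component_strip by blast
  moreover have "infinite (range strip)"
    by (simp add: finite_image_iff[OF inj_strip] infinite_UNIV_char_0)
  ultimately show "infinite {U. attracting_fatou_component sine_skew U}"
    using finite_subset by blast
qed

end
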